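(* A surjective quandle homomorphism $f\colon A\to B$ is a normal extension if and only if the following condition holds: for all $n$, all $a_i\in A$ ($0\le i\le n$) and all $\alpha_j\in\{-1,1\}$ ($1\le j\le n$), if \[ a_0\lhd^{\alpha_1}a_1\lhd^{\alpha_2}\cdots\lhd^{\alpha_n}a_n=a_0, \] then \[ a_0'\lhd^{\alpha_1}a_1'\lhd^{\alpha_2}\cdots\lhd^{\alpha_n}a_n'=a_0' \] for all $a_i'\in f^{-1}(f(a_i))$ ($0\le i\le n$).
   Context: A quandle is a (possibly empty) set $A$ with two binary operations $\lhd,\lhd^{-1}$ such that for all $a,b,c\in A$: $a\lhd a=a$; $(a\lhd b)\lhd^{-1}b=a=(a\lhd^{-1}b)\lhd b$; $(a\lhd b)\lhd c=(a\lhd c)\lhd(b\lhd c)$. Homomorphisms preserve both operations. Write $\lhd^{1}=\lhd$; iterated expressions without parentheses are bracketed from the left, e.g. $a\lhd b\lhd c=(a\lhd b)\lhd c$. A quandle is trivial if $a\lhd a'=a=a\lhd^{-1}a'$ for all $a,a'$. For a quandle $A$, $\mathrm{Inn}(A)$ is the subgroup of $\mathrm{Aut}(A)$ generated by all right translations $a\mapsto a\lhd b$ ($b\in A$); $\pi_0(A)$ is the set of orbits of $A$ under $\mathrm{Inn}(A)$, regarded as a trivial quandle, and $\eta_A\colon A\to\pi_0(A)$ sends an element to its orbit. The functor $\pi_0$ is the reflection of quandles into trivial quandles, with unit $\eta$. An extension is a surjective quandle homomorphism $f\colon A\to B$. It is trivial if the naturality square $\pi_0(f)\circ\eta_A=\eta_B\circ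 f$ is a pullback. It is normal if the first projection $f_1\colon\mathrm{Eq}(f)\to A$ is a trivial extension, where $\mathrm{Eq}(f)=\{(a,a')\in A\times A : f(a)=f(a')\}$ (a subquandle of $A\times A$). *)

theory Defs
  imports "HOL-Algebra.Group_Action" "HOL-Algebra.Generated_Groups"
begin

section \<open>Quandles and their homomorphisms\<close>

record 'a quandle_ops = "'a partial_object" +
  qmul :: "'a \<Rightarrow> 'a \<Rightarrow> 'a" (infixl "\<triangleleft>\<index>" 70)
  qdiv :: "'a \<Rightarrow> 'a \<Rightarrow> 'a" (infixl "\<triangleleft>\<inverse>\<index>" 70)

locale quandle =
  fixes A :: "('a, 'm) quandle_ops_scheme" (structure)
  assumes mul_closed: "\<lbrakk>a \<in> carrier A; b \<in> carrier A\<rbrakk> \<Longrightarrow> a \<triangleleft> b \<in> carrier A"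
    and div_closed: "\<lbrakk>a \<in> carrier A; b \<in> carrier A\<rbrakk> \<Longrightarrow> a \<triangleleft>\<inverse> b \<in> carrier A"
    and idem: "a \<in> carrier A \<Longrightarrow> a \<triangleleft> a = a"
    and mul_div: "\<lbrakk>a \<in> carrier A; b \<in> carrier A\<rbrakk> \<Longrightarrow> (a \<triangleleft> b) \<triangleleft>\<inverse> b = a"
    and div_mul: "\<lbrakk>a \<in> carrier A; b \<in> carrier A\<rbrakk> \<Longrightarrow> (a \<triangleleft>\<inverse> b) \<triangleleft> b = a"
    and self_distrib: "\<lbrakk>a \<in> carrier A; b \<in> carrier A; c \<in> carrier A\<rbrakk>
      \<Longrightarrow> (a \<triangleleft> b) \<triangleleft> c = (a \<triangleleft> c) \<triangleleft> (b \<triangleleft> c)"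

definition qhom :: "('a, 'm) quandle_ops_scheme \<Rightarrow> ('b, 'n) quandle_ops_scheme \<Rightarrow> ('a \<Rightarrow> 'b) set"
  where "qhom A B = {f \<in> carrier A \<rightarrow> carrier B.
    \<forall>x\<in>carrier A. \<forall>y\<in>carrier A.
      f (x \<triangleleft>\<^bsub>A\<^esub> y) = f x \<triangleleft>\<^bsub>B\<^esub> f y \<and> f (x \<triangleleft>\<inverse>\<^bsub>A\<^esub> y) = f x \<triangleleft>\<inverse>\<^bsub>B\<^esub> f y}"

definition qiso :: "('a, 'm) quandle_ops_scheme \<Rightarrow> ('b, 'n) quandle_ops_scheme \<Rightarrow> ('a \<Rightarrow> 'b) set"
  where "qiso A B = {f \<in> qhom A B. bij_betw f (carrier A) (carrier B)}"


section \<open>Inner automorphisms and connected components\<close>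

definition AutQ :: "('a, 'm) quandle_ops_scheme \<Rightarrow> ('a \<Rightarrow> 'a) monoid"
  where "AutQ A = BijGroup (carrier A) \<lparr>carrier := qhom A A \<inter> Bij (carrier A)\<rparr>"

definition right_translations :: "('a, 'm) quandle_ops_scheme \<Rightarrow> ('a \<Rightarrow> 'a) set"
  where "right_translations A = {(\<lambda>a\<in>carrier A. a \<triangleleft>\<^bsub>A\<^esub> b) | b. b \<in> carrier A}"

definition Inn :: "('a, 'm) quandle_ops_scheme \<Rightarrow> ('a \<Rightarrow> 'a) monoid"
  where "Inn A = subgroup_generated (AutQ A) (right_translations A)"

definition trivial_quandle_on :: "'a set \<Rightarrow> 'a quandle_ops"
  where "trivial_quandle_on S = \<lparr>carrier = S, qmul = (\<lambda>x y. x), qdiv = (\<lambda>x y. x)\<rparr>"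

definition pi0 :: "('a, 'm) quandle_ops_scheme \<Rightarrow> 'a set quandle_ops"
  where "pi0 A = trivial_quandle_on (orbits (Inn A) (carrier A) (\<lambda>g. g))"

definition eta :: "('a, 'm) quandle_ops_scheme \<Rightarrow> 'a \<Rightarrow> 'a set"
  where "eta A a = orbit (Inn A) (\<lambda>g. g) a"

text \<open>The action of the functor on a homomorphism \<open>f\<close> sends the orbit of \<open>a\<close> to the orbit of
  \<open>f a\<close>; that this is independent of \<open>a\<close> is proved as \<open>pi0_map_eta\<close> below.\<close>

definition pi0_map :: "('b, 'n) quandle_ops_scheme \<Rightarrow> ('a \<Rightarrow> 'b) \<Rightarrow> 'a set \<Rightarrow> 'b set"
  where "pi0_map B f X = the_elem ((\<lambda>x. eta B (f x)) ` X)"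


section \<open>Pullbacks\<close>

definition fiber_product :: "('a, 'm) quandle_ops_scheme \<Rightarrow> ('b, 'n) quandle_ops_scheme
    \<Rightarrow> ('a \<Rightarrow> 'c) \<Rightarrow> ('b \<Rightarrow> 'c) \<Rightarrow> ('a \<times> 'b) quandle_ops"
  where "fiber_product A B f g =
    \<lparr>carrier = {(a, b) \<in> carrier A \<times> carrier B. f a = g b},
     qmul = (\<lambda>(a, b) (a', b'). (a \<triangleleft>\<^bsub>A\<^esub> a', b \<triangleleft>\<^bsub>B\<^esub> b')),
     qdiv = (\<lambda>(a, b) (a', b'). (a \<triangleleft>\<inverse>\<^bsub>A\<^esub> a', b \<triangleleft>\<inverse>\<^bsub>B\<^esub> b'))\<rparr>"

text \<open>The square \<open>f \<circ> p = g \<circ> q\<close> with \<open>p : P \<rightarrow> A\<close>, \<open>q : P \<rightarrow> B\<close>, \<open>f : A \<rightarrow> C\<close>, \<open>g : B \<rightarrow> C\<close> is a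
  pullback if the comparison map from \<open>P\<close> to the fibre product is an isomorphism. The universal
  property, for test objects of arbitrary type, is \<open>is_pullback_universal\<close> below.\<close>

definition is_pullback :: "('p, 'k) quandle_ops_scheme \<Rightarrow> ('a, 'l) quandle_ops_scheme
    \<Rightarrow> ('b, 'm) quandle_ops_scheme \<Rightarrow> ('c, 'n) quandle_ops_scheme
    \<Rightarrow> ('p \<Rightarrow> 'a) \<Rightarrow> ('p \<Rightarrow> 'b) \<Rightarrow> ('a \<Rightarrow> 'c) \<Rightarrow> ('b \<Rightarrow> 'c) \<Rightarrow> bool"
  where "is_pullback P A B C p q f g \<longleftrightarrow>
    p \<in> qhom P A \<and> q \<in> qhom P B \<and> f \<in> qhom A C \<and> g \<in> qhom B C \<and>
    (\<forall>x\<in>carrier P. f (p x) = g (q x)) \<and>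
    (\<lambda>x. (p x, q x)) \<in> qiso P (fiber_product A B f g)"


section \<open>Extensions\<close>

definition extension :: "('a, 'm) quandle_ops_scheme \<Rightarrow> ('b, 'n) quandle_ops_scheme
    \<Rightarrow> ('a \<Rightarrow> 'b) \<Rightarrow> bool"
  where "extension A B f \<longleftrightarrow>
    quandle A \<and> quandle B \<and> f \<in> qhom A B \<and> f ` carrier A = carrier B"

definition trivial_extension :: "('a, 'm) quandle_ops_scheme \<Rightarrow> ('b, 'n) quandle_ops_scheme
    \<Rightarrow> ('a \<Rightarrow> 'b) \<Rightarrow> bool"
  where "trivial_extension A B f \<longleftrightarrow> extension A B f \<and>
    is_pullback A B (pi0 A) (pi0 B) f (eta A) (eta B) (pi0_map B f)"

definition Eq :: "('a, 'm) quandle_ops_scheme \<Rightarrow> ('a \<Rightarrow> 'b) \<Rightarrow> ('a \<times> 'a) quandle_ops"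
  where "Eq A f = fiber_product A A f f"

definition normal_extension :: "('a, 'm) quandle_ops_scheme \<Rightarrow> ('b, 'n) quandle_ops_scheme
    \<Rightarrow> ('a \<Rightarrow> 'b) \<Rightarrow> bool"
  where "normal_extension A B f \<longleftrightarrow> extension A B f \<and> trivial_extension (Eq A f) A fst"


section \<open>Iterated expressions\<close>

text \<open>Only the exponents \<open>1\<close> and \<open>-1\<close> are meaningful.\<close>

definition qpow :: "('a, 'm) quandle_ops_scheme \<Rightarrow> int \<Rightarrow> 'a \<Rightarrow> 'a \<Rightarrow> 'a"
  where "qpow A e x y = (if e = 1 then x \<triangleleft>\<^bsub>A\<^esub> y else x \<triangleleft>\<inverse>\<^bsub>A\<^esub> y)"

primrec qword :: "('a, 'm) quandle_ops_scheme \<Rightarrow> (nat \<Rightarrow> int) \<Rightarrow> (nat \<Rightarrow> 'a) \<Rightarrow> nat \<Rightarrow> 'a"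
  where
    "qword A \<alpha> a 0 = a 0"
  | "qword A \<alpha> a (Suc n) = qpow A (\<alpha> (Suc n)) (qword A \<alpha> a n) (a (Suc n))"


section \<open>Well-definedness\<close>

lemma quandle_trivial_quandle_on: "quandle (trivial_quandle_on S)"
  by unfold_locales (auto simp: trivial_quandle_on_def)

lemma quandle_fiber_product:
  assumes "quandle A" "quandle B" "f \<in> qhom A C" "g \<in> qhom B C"
  shows "quandle (fiber_product A B f g)"
proof -
  interpret A: quandle A by fact
  interpret B: quandle B by fact
  show ?thesis
    using assms(3,4)
    by unfold_locales
       (auto simp: fiber_product_def qhom_def Pi_iff A.mul_closed A.div_closed B.mul_closed
          B.div_closed A.idem B.idem A.mul_div B.mul_div A.div_mul B.div_mul
          intro: A.self_distrib B.self_distrib)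
qed

lemma is_pullback_universal:
  assumes pb: "is_pullback P A B C p q f g"
    and u: "u \<in> qhom T A" and v: "v \<in> qhom T B"
    and comm: "\<And>t. t \<in> carrier T \<Longrightarrow> f (u t) = g (v t)"
    and "quandle T" "quandle P"
  shows "\<exists>!h. h \<in> qhom T P \<inter> extensional (carrier T) \<and>
    (\<forall>t\<in>carrier T. p (h t) = u t \<and> q (h t) = v t)"
proof -
  interpret T: quandle T by fact
  interpret P: quandle P by fact
  let ?c = "\<lambda>x. (p x, q x)" and ?F = "fiber_product A B f g"
  have bij: "bij_betw ?c (carrier P) (carrier ?F)" and p: "p \<in> qhom P A" and q: "q \<in> qhom P B"
    using pb by (auto simp: is_pullback_def qiso_def)
  have inj: "x = y" if "x \<in> carrier P" "y \<in> carrier P" "p x = p y" "q x = q y" for x y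
    using bij that by (auto simp: bij_betw_def inj_on_def)
  have "\<exists>x\<in>carrier P. p x = u t \<and> q x = v t" if "t \<in> carrier T" for t
  proof -
    have "(u t, v t) \<in> ?c ` carrier P"
      using bij that u v comm by (auto simp: bij_betw_def fiber_product_def qhom_def Pi_iff)
    then show ?thesis by auto
  qed
  then obtain h0 where h0: "\<And>t. t \<in> carrier T \<Longrightarrow> h0 t \<in> carrier P \<and> p (h0 t) = u t \<and> q (h0 t) = v t"
    by metis
  define h where "h = restrict h0 (carrier T)"
  have h: "h t \<in> carrier P" "p (h t) = u t" "q (h t) = v t" if "t \<in> carrier T" for t
    using h0 that by (auto simp: h_def)
  have "h \<in> qhom T P"
    unfolding qhom_def
  proof (intro CollectI conjI ballI)
    show "h \<in> carrier T \<rightarrow> carrier P" using h by auto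
  next
    fix x y assume xy: "x \<in> carrier T" "y \<in> carrier T"
    show "h (x \<triangleleft>\<^bsub>T\<^esub> y) = h x \<triangleleft>\<^bsub>P\<^esub> h y"
      using xy h p q u v by (intro inj) (auto simp: T.mul_closed P.mul_closed qhom_def)
    show "h (x \<triangleleft>\<inverse>\<^bsub>T\<^esub> y) = h x \<triangleleft>\<inverse>\<^bsub>P\<^esub> h y"
      using xy h p q u v by (intro inj) (auto simp: T.div_closed P.div_closed qhom_def)
  qed
  then have "h \<in> qhom T P \<inter> extensional (carrier T) \<and>
    (\<forall>t\<in>carrier T. p (h t) = u t \<and> q (h t) = v t)"
    using h by (auto simp: h_def)
  moreover have "k = h" if "k \<in> qhom T P \<inter> extensional (carrier T) \<and>
    (\<forall>t\<in>carrier T. p (k t) = u t \<and> q (k t) = v t)" for k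
  proof (rule extensionalityI[of _ "carrier T"])
    show "k \<in> extensional (carrier T)" "h \<in> extensional (carrier T)" 
      using that by (auto simp: h_def)
    show "k t = h t" if "t \<in> carrier T" for t
      using that h \<open>k \<in> _ \<and> _\<close> by (intro inj) (auto simp: qhom_def)
  qed
  ultimately show ?thesis by blast
qed

context quandle
begin

lemma div_distrib_mul:
  assumes "a \<in> carrier A" "b \<in> carrier A" "c \<in> carrier A"
  shows "(a \<triangleleft>\<inverse> b) \<triangleleft> c = (a \<triangleleft> c) \<triangleleft>\<inverse> (b \<triangleleft> c)"
  using assms by (metis div_closed div_mul mul_closed mul_div self_distrib)

lemma right_translations_subset: "right_translations A \<subseteq> carrier (AutQ A)"
proof -
  have "bij_betw (\<lambda>a\<in>carrier A. a \<triangleleft> b) (carrier A) (carrier A)" if "b \<in> carrier A" for b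
    using that
    by (intro bij_betw_byWitness[where f' = "\<lambda>a. a \<triangleleft>\<inverse> b"])
       (auto simp: mul_closed div_closed mul_div div_mul)
  then show ?thesis
    by (auto simp: right_translations_def AutQ_def Bij_def qhom_def mul_closed div_closed
      intro: self_distrib div_distrib_mul)
qed

lemma subgroup_AutQ: "subgroup (qhom A A \<inter> Bij (carrier A)) (BijGroup (carrier A))"
proof (rule subgroup.intro)
  fix g assume g: "g \<in> qhom A A \<inter> Bij (carrier A)"
  then have "(\<lambda>x\<in>carrier A. inv_into (carrier A) g x) \<in> qhom A A"
    by (auto simp: qhom_def Bij_inv_into_mem mul_closed div_closed
      intro!: Bij_inv_into_lemma)
  with g show "inv\<^bsub>BijGroup (carrier A)\<^esub> g \<in> qhom A A \<inter> Bij (carrier A)"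
    by (simp add: inv_BijGroup restrict_inv_into_Bij)
next
  fix g h assume gh: "g \<in> qhom A A \<inter> Bij (carrier A)" "h \<in> qhom A A \<inter> Bij (carrier A)"
  then have "compose (carrier A) g h \<in> qhom A A"
    by (auto simp: qhom_def compose_def Pi_iff mul_closed div_closed)
  with gh show "g \<otimes>\<^bsub>BijGroup (carrier A)\<^esub> h \<in> qhom A A \<inter> Bij (carrier A)"
    by (simp add: BijGroup_def compose_Bij)
qed (auto simp: BijGroup_def id_Bij qhom_def mul_closed div_closed)

lemma group_AutQ: "group (AutQ A)"
  unfolding AutQ_def by (rule subgroup.subgroup_is_group[OF subgroup_AutQ group_BijGroup])

lemma carrier_Inn: "carrier (Inn A) = generate (AutQ A) (right_translations A)"
  using right_translations_subset by (simp add: Inn_def carrier_subgroup_generated Int_absorb1)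

lemma Inn_carrier: "g \<in> carrier (Inn A) \<Longrightarrow> x \<in> carrier A \<Longrightarrow> g x \<in> carrier A"
proof -
  assume g: "g \<in> carrier (Inn A)" and x: "x \<in> carrier A"
  have "g \<in> carrier (AutQ A)"
    using g unfolding carrier_Inn
    by (rule group.generate_in_carrier[OF group_AutQ right_translations_subset])
  then have "g \<in> carrier A \<rightarrow> carrier A" by (simp add: AutQ_def qhom_def)
  with x show "g x \<in> carrier A" by (rule funcset_mem[rotated])
qed

lemma inv_AutQ:
  assumes "g \<in> carrier (AutQ A)"
  shows "inv\<^bsub>AutQ A\<^esub> g = (\<lambda>x\<in>carrier A. inv_into (carrier A) g x)"
  using assms group.m_inv_consistent[OF group_BijGroup subgroup_AutQ, of g]
  by (simp add: AutQ_def inv_BijGroup)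

lemma inv_right_translation:
  assumes "b \<in> carrier A"
  shows "inv\<^bsub>AutQ A\<^esub> (\<lambda>a\<in>carrier A. a \<triangleleft> b) = (\<lambda>a\<in>carrier A. a \<triangleleft>\<inverse> b)"
proof -
  have m: "(\<lambda>a\<in>carrier A. a \<triangleleft> b) \<in> carrier (AutQ A)"
    using assms right_translations_subset by (auto simp: right_translations_def)
  then have "inj_on (\<lambda>a\<in>carrier A. a \<triangleleft> b) (carrier A)"
    by (auto simp: AutQ_def Bij_def bij_betw_def)
  then show ?thesis
    unfolding inv_AutQ[OF m] using assms
    by (intro restrict_ext inv_into_f_eq) (auto simp: div_closed div_mul)
qed

lemma mult_AutQ:
  assumes "g \<in> carrier (AutQ A)" "h \<in> carrier (AutQ A)"
  shows "g \<otimes>\<^bsub>AutQ A\<^esub> h = compose (carrier A) g h"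
  using assms by (simp add: AutQ_def BijGroup_def)

lemma eta_in_pi0: "a \<in> carrier A \<Longrightarrow> eta A a \<in> carrier (pi0 A)"
  by (auto simp: pi0_def trivial_quandle_on_def eta_def orbits_def)

lemma group_action_Inn: "group_action (Inn A) (carrier A) (\<lambda>g. g)"
proof -
  have sub: "carrier (Inn A) \<subseteq> carrier (AutQ A)"
    using group.generate_in_carrier[OF group_AutQ right_translations_subset]
    by (auto simp: carrier_Inn)
  then have "(\<lambda>g. g) \<in> hom (Inn A) (BijGroup (carrier A))"
    by (auto simp: hom_def Inn_def subgroup_generated_def AutQ_def BijGroup_def)
  moreover have "group (Inn A)"
    unfolding Inn_def by (rule group.group_subgroup_generated[OF group_AutQ])
  ultimately show ?thesis
    by (simp add: group_action_def group_hom_def group_hom_axioms_def group_BijGroup)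
qed

lemma eta_subset: "x \<in> carrier A \<Longrightarrow> eta A x \<subseteq> carrier A"
  unfolding eta_def orbit_def using Inn_carrier by blast

lemma eta_refl: "x \<in> carrier A \<Longrightarrow> x \<in> eta A x"
  unfolding eta_def by (rule group_action.orbit_refl[OF group_action_Inn])

lemma eta_eqI:
  assumes "y \<in> eta A x" "x \<in> carrier A"
  shows "eta A y = eta A x"
proof -
  interpret act: group_action "Inn A" "carrier A" "\<lambda>g. g" by (rule group_action_Inn)
  have y: "y \<in> carrier A" using assms eta_subset by blast
  have "x \<in> eta A y"
    using act.orbit_sym[OF assms(2) y] assms(1) unfolding eta_def by blast
  moreover have "eta A v \<subseteq> eta A u"
    if "u \<in> carrier A" "v \<in> carrier A" "v \<in> eta A u" for u v
    using act.orbit_trans[OF that(1,2)] eta_subset[OF that(2)] that(3)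
    unfolding eta_def by blast
  ultimately show ?thesis using assms y by blast
qed

lemma right_translation_Inn: "b \<in> carrier A \<Longrightarrow> (\<lambda>a\<in>carrier A. a \<triangleleft> b) \<in> carrier (Inn A)"
  by (auto simp: carrier_Inn right_translations_def intro!: generate.incl)

lemma right_translation_inverse_Inn: "b \<in> carrier A \<Longrightarrow> (\<lambda>a\<in>carrier A. a \<triangleleft>\<inverse> b) \<in> carrier (Inn A)"
  using generate.inv[of "\<lambda>a\<in>carrier A. a \<triangleleft> b" "right_translations A" "AutQ A"]
  by (auto simp: carrier_Inn right_translations_def inv_right_translation)

lemma eta_image_eq:
  assumes "g \<in> carrier (Inn A)" "x \<in> carrier A"
  shows "eta A (g x) = eta A x"
  using assms by (intro eta_eqI) (auto simp: eta_def orbit_def)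

lemma eta_mul: "\<lbrakk>a \<in> carrier A; b \<in> carrier A\<rbrakk> \<Longrightarrow> eta A (a \<triangleleft> b) = eta A a"
  using eta_image_eq[OF right_translation_Inn, of b a] by simp

lemma eta_div: "\<lbrakk>a \<in> carrier A; b \<in> carrier A\<rbrakk> \<Longrightarrow> eta A (a \<triangleleft>\<inverse> b) = eta A a"
  using eta_image_eq[OF right_translation_inverse_Inn, of b a] by simp

lemma eta_qhom: "eta A \<in> qhom A (pi0 A)"
  using eta_in_pi0 by (auto simp: qhom_def eta_mul eta_div) (auto simp: pi0_def trivial_quandle_on_def)

end

lemma pi0_map_eta:
  assumes "quandle A" "quandle B" and f: "f \<in> qhom A B" and "a \<in> carrier A"
  shows "pi0_map B f (eta A a) = eta B (f a)"
proof -
  interpret A: quandle A by fact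
  interpret B: quandle B by fact
  have "\<forall>x\<in>carrier A. eta B (f (g x)) = eta B (f x)"
    if "g \<in> generate (AutQ A) (right_translations A)" for g
    using that
  proof induction
    case one
    then show ?case by (simp add: AutQ_def BijGroup_def)
  next
    case (incl h)
    then show ?case using f
      by (auto simp: right_translations_def qhom_def Pi_iff B.eta_mul)
  next
    case (inv h)
    then show ?case using f
      by (auto simp: right_translations_def qhom_def Pi_iff B.eta_div A.inv_right_translation)
  next
    case (eng h1 h2)
    then have "h1 \<in> carrier (AutQ A)" "h2 \<in> carrier (AutQ A)"
      using group.generate_in_carrier[OF A.group_AutQ A.right_translations_subset] by auto
    with eng show ?case
      using A.Inn_carrier[of h2] by (simp add: A.mult_AutQ compose_def A.carrier_Inn)
  qed
  then have "eta B (f x) = eta B (f a)" if "x \<in> eta A a" for x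
    using that \<open>a \<in> carrier A\<close>
    unfolding eta_def[of A] orbit_def A.carrier_Inn by blast
  then have "(\<lambda>x. eta B (f x)) ` eta A a = {eta B (f a)}"
    using A.eta_refl[OF \<open>a \<in> carrier A\<close>] by blast
  then show ?thesis by (simp add: pi0_map_def)
qed

lemma pi0_map_qhom:
  assumes "quandle A" "quandle B" "f \<in> qhom A B"
  shows "pi0_map B f \<in> qhom (pi0 A) (pi0 B)"
proof -
  have "pi0_map B f X \<in> carrier (pi0 B)" if X: "X \<in> carrier (pi0 A)" for X
  proof -
    obtain a where a: "a \<in> carrier A" "X = eta A a"
      using X by (auto simp: pi0_def trivial_quandle_on_def orbits_def eta_def)
    then have "f a \<in> carrier B" using assms(3) by (auto simp: qhom_def)
    then show ?thesis
      using quandle.eta_in_pi0[OF assms(2)] pi0_map_eta[OF assms a(1)] a(2) by simp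
  qed
  then show ?thesis
    by (auto simp: qhom_def) (auto simp: pi0_def trivial_quandle_on_def)
qed

end

theory Submission
  imports Defs
begin

text \<open>The naturality square of any extension \<open>f\<close> has a surjective comparison map, because a path
  of translations in the codomain lifts along \<open>f\<close>. Hence \<open>f\<close> is trivial iff \<open>f\<close> is injective on
  each orbit. An orbit of \<open>Eq A f\<close> consists of pairs of values of one word, evaluated at
  componentwise \<open>f\<close>-related arguments, so injectivity of the first projection on orbits is the
  stated condition on words.\<close>

section \<open>Orbits under inner automorphisms as sets of word values\<close>

context quandle
begin

text \<open>An induction principle for orbits. \<open>Inn A\<close> is generated by right
  translations, and the inverse of the translation by \<open>b\<close> is right division by
  \<open>b\<close>; so the two closure conditions on \<open>S\<close> pass to every inner
  automorphism by induction over \<open>generate\<close>.\<close>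

lemma eta_subset_invariant:
  assumes "x \<in> S" "S \<subseteq> carrier A"
    and "\<And>y b. y \<in> S \<Longrightarrow> b \<in> carrier A \<Longrightarrow> y \<triangleleft> b \<in> S"
    and "\<And>y b. y \<in> S \<Longrightarrow> b \<in> carrier A \<Longrightarrow> y \<triangleleft>\<inverse> b \<in> S"
  shows "eta A x \<subseteq> S"
proof -
  have "\<forall>y\<in>S. g y \<in> S" if "g \<in> generate (AutQ A) (right_translations A)" for g
    using that
  proof induction
    case one
    then show ?case using assms(2) by (auto simp: AutQ_def BijGroup_def)
  next
    case (incl h)
    then show ?case using assms(2,3) by (auto simp: right_translations_def)
  next
    case (inv h)
    then show ?case using assms(2,4) by (auto simp: right_translations_def inv_right_translation)
  next
    case (eng h1 h2)
    then have "h1 \<in> carrier (AutQ A)" "h2 \<in> carrier (AutQ A)"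
      using group.generate_in_carrier[OF group_AutQ right_translations_subset] by auto
    with eng show ?case
      using assms(2) by (auto simp: mult_AutQ compose_def)
  qed
  then show ?thesis
    using assms(1) by (auto simp: eta_def orbit_def carrier_Inn)
qed

lemma qpow_closed: "\<lbrakk>x \<in> carrier A; y \<in> carrier A\<rbrakk> \<Longrightarrow> qpow A e x y \<in> carrier A"
  by (simp add: qpow_def mul_closed div_closed)

lemma qword_closed: "(\<And>i. i \<le> n \<Longrightarrow> a i \<in> carrier A) \<Longrightarrow> qword A \<alpha> a n \<in> carrier A"
  by (induction n) (auto simp: qpow_closed)

lemma eta_qword: "(\<And>i. i \<le> n \<Longrightarrow> a i \<in> carrier A) \<Longrightarrow> eta A (qword A \<alpha> a n) = eta A (a 0)"
  by (induction n) (auto simp: qpow_def eta_mul eta_div qword_closed)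

end

lemma qword_cong:
  "(\<And>i. i \<le> n \<Longrightarrow> a i = b i) \<Longrightarrow> (\<And>j. j \<in> {1..n} \<Longrightarrow> \<alpha> j = \<beta> j) \<Longrightarrow>
    qword A \<alpha> a n = qword A \<beta> b n"
  by (induction n) auto

text \<open>A concrete form of the orbit of \<open>x\<close>. The exponents are restricted to signs
  because \<open>qpow\<close> treats every integer other than 1 like -1, while the word condition to
  be matched speaks of signs only.\<close>

definition qwords :: "('a, 'm) quandle_ops_scheme \<Rightarrow> 'a \<Rightarrow> 'a set"
  where "qwords A x = {qword A \<alpha> a n | \<alpha> a n.
    a 0 = x \<and> (\<forall>i\<le>n. a i \<in> carrier A) \<and> (\<forall>j\<in>{1..n}. \<alpha> j \<in> {-1, 1})}"

lemma qpow_in_qwords: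
  assumes "y \<in> qwords A x" "b \<in> carrier A" "e \<in> {-1, 1}"
  shows "qpow A e y b \<in> qwords A x"
proof -
  obtain \<alpha> a n where w: "y = qword A \<alpha> a n" "a 0 = x" "\<forall>i\<le>n. a i \<in> carrier A"
      "\<forall>j\<in>{1..n}. \<alpha> j \<in> {-1, 1}"
    using assms(1) by (auto simp: qwords_def)
  \<comment> \<open>One more letter: a word of length \<open>n\<close> reads no index beyond
    \<open>n\<close>, so updating both sequences at \<open>Suc n\<close> leaves its value
    \<open>y\<close> unchanged.\<close>
  let ?\<alpha> = "\<alpha>(Suc n := e)" and ?a = "a(Suc n := b)"
  have "qword A ?\<alpha> ?a n = y"
    unfolding w(1) by (rule qword_cong) auto
  then have "qpow A e y b = qword A ?\<alpha> ?a (Suc n)" by simp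
  moreover have "?a 0 = x" "\<forall>i\<le>Suc n. ?a i \<in> carrier A" "\<forall>j\<in>{1..Suc n}. ?\<alpha> j \<in> {-1, 1}"
    using w assms(2,3) by (auto simp: le_Suc_eq)
  ultimately show ?thesis
    unfolding qwords_def by blast
qed

text \<open>The word values starting from \<open>x\<close> contain \<open>x\<close> and are closed
  under appending a letter, so they contain the orbit; conversely, no letter of a word moves its
  value out of the orbit of the first entry.\<close>

lemma (in quandle) eta_eq_qwords:
  assumes "x \<in> carrier A"
  shows "eta A x = qwords A x"
proof
  show "eta A x \<subseteq> qwords A x"
  proof (rule eta_subset_invariant)
    \<comment> \<open>The empty word: at length 0 no exponent is read, so the constant 1 is
      arbitrary.\<close>
    have "x = qword A (\<lambda>_. 1) (\<lambda>_. x) 0" by simp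
    then show "x \<in> qwords A x"
      using assms unfolding qwords_def by blast
    show "qwords A x \<subseteq> carrier A"
      by (auto simp: qwords_def qword_closed)
    show "y \<triangleleft> b \<in> qwords A x" if "y \<in> qwords A x" "b \<in> carrier A" for y b
      using qpow_in_qwords[OF that, of 1] by (simp add: qpow_def)
    show "y \<triangleleft>\<inverse> b \<in> qwords A x" if "y \<in> qwords A x" "b \<in> carrier A" for y b
      using qpow_in_qwords[OF that, of "-1"] by (simp add: qpow_def)
  qed
next
  show "qwords A x \<subseteq> eta A x"
  proof
    fix y assume "y \<in> qwords A x"
    then obtain \<alpha> a n where w: "y = qword A \<alpha> a n" "a 0 = x" "\<And>i. i \<le> n \<Longrightarrow> a i \<in> carrier A"
      by (auto simp: qwords_def)
    then show "y \<in> eta A x"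
      using eta_qword[of n a \<alpha>] eta_refl[of y] qword_closed[of n a \<alpha>] by simp
  qed
qed

section \<open>Triviality as injectivity of the comparison map\<close>

text \<open>Path lifting: by surjectivity each letter of \<open>B\<close> is some
  \<open>f c\<close>, and translating \<open>f a\<close> by it gives the image of \<open>a\<close>
  translated by \<open>c\<close>. So the image of an orbit is closed under all translations of
  \<open>B\<close>.\<close>

lemma eta_subset_image:
  assumes "extension A B f" "x \<in> carrier A"
  shows "eta B (f x) \<subseteq> f ` eta A x"
proof -
  interpret A: quandle A using assms by (simp add: extension_def)
  interpret B: quandle B using assms by (simp add: extension_def)
  have f: "f \<in> qhom A B" and surj: "f ` carrier A = carrier B"
    using assms by (auto simp: extension_def)
  show ?thesis
  proof (rule B.eta_subset_invariant)
    show "f x \<in> f ` eta A x" using A.eta_refl assms(2) by blast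
    show "f ` eta A x \<subseteq> carrier B" using A.eta_subset[OF assms(2)] surj by blast
    fix y b assume y: "y \<in> f ` eta A x" and "b \<in> carrier B"
    then obtain a c where a: "a \<in> eta A x" "y = f a" and c: "c \<in> carrier A" "b = f c"
      using surj by blast
    have a': "a \<in> carrier A" "eta A a = eta A x"
      using a A.eta_subset A.eta_eqI assms(2) by blast+
    have "a \<triangleleft>\<^bsub>A\<^esub> c \<in> eta A x" "a \<triangleleft>\<inverse>\<^bsub>A\<^esub> c \<in> eta A x"
      using a' c A.eta_refl[of "a \<triangleleft>\<^bsub>A\<^esub> c"] A.eta_refl[of "a \<triangleleft>\<inverse>\<^bsub>A\<^esub> c"]
      by (auto simp: A.eta_mul A.eta_div A.mul_closed A.div_closed)
    moreover have "y \<triangleleft>\<^bsub>B\<^esub> b = f (a \<triangleleft>\<^bsub>A\<^esub> c)" "y \<triangleleft>\<inverse>\<^bsub>B\<^esub> b = f (a \<triangleleft>\<inverse>\<^bsub>A\<^esub> c)"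
      using a a' c f by (auto simp: qhom_def)
    ultimately show "y \<triangleleft>\<^bsub>B\<^esub> b \<in> f ` eta A x" "y \<triangleleft>\<inverse>\<^bsub>B\<^esub> b \<in> f ` eta A x"
      by blast+
  qed
qed

text \<open>The square commutes by \<open>pi0_map_eta\<close>, and the comparison map is a
  surjective homomorphism for every extension; only its injectivity is left of the pullback
  condition.\<close>

lemma trivial_extension_iff_inj_on:
  assumes ext: "extension A B f"
  shows "trivial_extension A B f \<longleftrightarrow> inj_on (\<lambda>x. (f x, eta A x)) (carrier A)"
proof -
  interpret A: quandle A using ext by (simp add: extension_def)
  interpret B: quandle B using ext by (simp add: extension_def)
  have f: "f \<in> qhom A B" using ext by (simp add: extension_def)
  let ?F = "fiber_product B (pi0 A) (eta B) (pi0_map B f)" and ?c = "\<lambda>x. (f x, eta A x)"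
  note pe = pi0_map_eta[OF A.quandle_axioms B.quandle_axioms f]
  have image: "?c ` carrier A = carrier ?F"
  proof
    show "?c ` carrier A \<subseteq> carrier ?F"
      using f pe A.eta_in_pi0 by (auto simp: fiber_product_def qhom_def Pi_iff)
    show "carrier ?F \<subseteq> ?c ` carrier A"
    proof
      fix p assume p: "p \<in> carrier ?F"
      then obtain a where a: "a \<in> carrier A" "snd p = eta A a"
        by (auto simp: fiber_product_def pi0_def trivial_quandle_on_def orbits_def eta_def)
      \<comment> \<open>Compatibility of the two components says that \<open>fst p\<close> lies in
        the orbit of \<open>f a\<close>. Lifting then replaces \<open>a\<close> by some
        \<open>a'\<close> in the same orbit that lies exactly over \<open>fst p\<close>.\<close>
      have b: "fst p \<in> carrier B" "eta B (fst p) = eta B (f a)"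
        using p a pe[OF a(1)] by (auto simp: fiber_product_def)
      then have "fst p \<in> f ` eta A a"
        using B.eta_refl[OF b(1)] eta_subset_image[OF ext a(1)] by auto
      then obtain a' where "a' \<in> eta A a" "fst p = f a'" by blast
      moreover from this have "a' \<in> carrier A" "eta A a' = eta A a"
        using A.eta_subset A.eta_eqI a(1) by blast+
      ultimately show "p \<in> ?c ` carrier A"
        using a(2) by (auto simp: image_iff prod_eq_iff)
    qed
  qed
  have "?c \<in> qhom A ?F"
  proof -
    have "?c \<in> carrier A \<rightarrow> carrier ?F" using image by blast
    then show ?thesis
      using f A.eta_qhom unfolding qhom_def by (auto simp: fiber_product_def)
  qed
  then have "?c \<in> qiso A ?F \<longleftrightarrow> inj_on ?c (carrier A)"
    using image by (simp add: qiso_def bij_betw_def)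
  then show ?thesis
    using ext f A.eta_qhom B.eta_qhom pi0_map_qhom[OF A.quandle_axioms B.quandle_axioms f] pe
    by (simp add: trivial_extension_def is_pullback_def)
qed

section \<open>The kernel pair and its words\<close>

lemma carrier_Eq: "p \<in> carrier (Eq A f) \<longleftrightarrow>
    fst p \<in> carrier A \<and> snd p \<in> carrier A \<and> f (fst p) = f (snd p)"
  by (cases p) (simp add: Eq_def fiber_product_def)

lemma qpow_Eq: "qpow (Eq A f) e p q = (qpow A e (fst p) (fst q), qpow A e (snd p) (snd q))"
  by (simp add: qpow_def Eq_def fiber_product_def split: prod.split)

text \<open>Since the operations of \<open>Eq A f\<close> are componentwise, one word there encodes
  two words of \<open>A\<close> that share their exponents.\<close>

lemma qword_Eq:
  "qword (Eq A f) \<alpha> c n = (qword A \<alpha> (\<lambda>i. fst (c i)) n, qword A \<alpha> (\<lambda>i. snd (c i)) n)"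
  by (induction n) (simp_all add: qpow_Eq)

lemma extension_fst_Eq:
  assumes "quandle A" "f \<in> qhom A B"
  shows "extension (Eq A f) A fst"
  unfolding extension_def
proof (intro conjI)
  show "quandle (Eq A f)"
    unfolding Eq_def using assms by (intro quandle_fiber_product)
  show "fst \<in> qhom (Eq A f) A"
    by (auto simp: qhom_def Eq_def fiber_product_def)
  show "fst ` carrier (Eq A f) = carrier A"
  proof
    show "carrier A \<subseteq> fst ` carrier (Eq A f)"
    proof
      fix x assume "x \<in> carrier A"
      \<comment> \<open>The diagonal is a section of the first projection.\<close>
      then have "(x, x) \<in> carrier (Eq A f)" by (simp add: carrier_Eq)
      then show "x \<in> fst ` carrier (Eq A f)" by (rule rev_image_eqI) simp
    qed
  qed (auto simp: carrier_Eq[of "(a, b)" for a b])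
qed fact

theorem proposition3p2:
  fixes A :: "('a, 'm) quandle_ops_scheme" and B :: "('b, 'n) quandle_ops_scheme"
    and f :: "'a \<Rightarrow> 'b"
  assumes "quandle A" and "quandle B" and "f \<in> qhom A B" and "f ` carrier A = carrier B"
  shows "normal_extension A B f \<longleftrightarrow>
    (\<forall>(n::nat) (a :: nat \<Rightarrow> 'a) (\<alpha> :: nat \<Rightarrow> int).
      (\<forall>i\<in>{0..n}. a i \<in> carrier A) \<longrightarrow>
      (\<forall>j\<in>{1..n}. \<alpha> j \<in> {-1, 1}) \<longrightarrow>
      qword A \<alpha> a n = a 0 \<longrightarrow>
      (\<forall>a' :: nat \<Rightarrow> 'a. (\<forall>i\<in>{0..n}. a' i \<in> carrier A \<and> f (a' i) = f (a i)) \<longrightarrow>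
        qword A \<alpha> a' n = a' 0))"
    (is "_ \<longleftrightarrow> ?words")
proof -
  let ?E = "Eq A f"
  have ext: "extension ?E A fst" by (rule extension_fst_Eq[OF assms(1,3)])
  interpret E: quandle ?E using ext by (simp add: extension_def)
  have "normal_extension A B f \<longleftrightarrow> inj_on (\<lambda>x. (fst x, eta ?E x)) (carrier ?E)"
    using assms trivial_extension_iff_inj_on[OF ext]
    by (simp add: normal_extension_def extension_def)
  also have "\<dots> \<longleftrightarrow> ?words"
  proof
    assume inj: "inj_on (\<lambda>x. (fst x, eta ?E x)) (carrier ?E)"
    show ?words
    proof (intro allI impI)
      fix n :: nat and a :: "nat \<Rightarrow> 'a" and \<alpha> :: "nat \<Rightarrow> int" and a' :: "nat \<Rightarrow> 'a"
      assume a: "\<forall>i\<in>{0..n}. a i \<in> carrier A" "qword A \<alpha> a n = a 0"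
        and a': "\<forall>i\<in>{0..n}. a' i \<in> carrier A \<and> f (a' i) = f (a i)"
      \<comment> \<open>Pairing the letters gives a word in \<open>Eq A f\<close>. Its first
        component returns to \<open>a 0\<close> and its value stays in the orbit of
        \<open>c 0\<close>, so injectivity closes the second component too.\<close>
      define c where "c i = (a i, a' i)" for i
      have c: "c i \<in> carrier ?E" if "i \<le> n" for i
        using a a' that by (simp add: c_def carrier_Eq)
      have w: "qword ?E \<alpha> c n = (a 0, qword A \<alpha> a' n)"
        using a by (simp add: qword_Eq c_def)
      have "qword ?E \<alpha> c n = c 0"
      proof (rule inj_onD[OF inj])
        show "(fst (qword ?E \<alpha> c n), eta ?E (qword ?E \<alpha> c n)) = (fst (c 0), eta ?E (c 0))"
          using E.eta_qword[of n c \<alpha>] c w by (simp add: c_def)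
        show "qword ?E \<alpha> c n \<in> carrier ?E" "c 0 \<in> carrier ?E"
          using E.qword_closed[of n c \<alpha>] c by auto
      qed
      then show "qword A \<alpha> a' n = a' 0" using w by (simp add: c_def)
    qed
  next
    assume words: ?words
    show "inj_on (\<lambda>x. (fst x, eta ?E x)) (carrier ?E)"
    proof (rule inj_onI)
      fix p q assume p: "p \<in> carrier ?E" and q: "q \<in> carrier ?E"
        and pq: "(fst p, eta ?E p) = (fst q, eta ?E q)"
      \<comment> \<open>Sharing an orbit, \<open>q\<close> is the value of a word starting at
        \<open>p\<close>. As \<open>fst p = fst q\<close>, its first component is a closed word of
        \<open>A\<close>; the word condition then closes the second, which is
        \<open>snd p = snd q\<close>.\<close>
      have "q \<in> qwords ?E p"
        using E.eta_refl[OF q] pq E.eta_eq_qwords[OF p] by simp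
      then obtain \<alpha> c n where c: "q = qword ?E \<alpha> c n" "c 0 = p" "\<forall>i\<le>n. c i \<in> carrier ?E"
          "\<forall>j\<in>{1..n}. \<alpha> j \<in> {-1, 1}"
        by (auto simp: qwords_def)
      have "qword A \<alpha> (\<lambda>i. fst (c i)) n = fst (c 0)"
        using c pq by (simp add: qword_Eq)
      moreover have "\<forall>i\<in>{0..n}. fst (c i) \<in> carrier A"
        "\<forall>i\<in>{0..n}. snd (c i) \<in> carrier A \<and> f (snd (c i)) = f (fst (c i))"
        using c(3) by (simp_all add: carrier_Eq)
      ultimately have "qword A \<alpha> (\<lambda>i. snd (c i)) n = snd (c 0)"
        using words[rule_format, of n "\<lambda>i. fst (c i)" \<alpha> "\<lambda>i. snd (c i)"] c(4) by simp
      then show "p = q"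
        using c pq by (simp add: qword_Eq prod_eq_iff)
    qed
  qed
  finally show ?thesis .
qed

end
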